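(* Let $(\mathcal{A}, \mathbb{E}_{\mathcal{A}}, \mathbb{F}_{\mathcal{A}}, \varepsilon)$ be a $\mathcal{B}$-$\mathcal{B}$-non-commutative probability space with a pair of $(\mathcal{B}, \mathcal{D})$-valued expectations. Then there exist a $\mathcal{B}$-$\mathcal{B}$-bimodule with a pair of specified $(\mathcal{B}, \mathcal{D})$-valued states $(\mathcal{X}, \mathcal{X}^\circ, \mathfrak{p}, \mathfrak{q})$ and a unital homomorphism $\theta: \mathcal{A} \to \mathcal{L}(\mathcal{X})$ such that $$\theta(L_{b_1}R_{b_2}) = L_{b_1}R_{b_2},\quad \theta(\mathcal{A}_\ell) \subset \mathcal{L}_\ell(\mathcal{X}),\quad \theta(\mathcal{A}_r) \subset \mathcal{L}_r(\mathcal{X}),$$ $$\mathbb{E}_{\mathcal{L}(\mathcal{X})}(\theta(Z)) = \mathbb{E}_{\mathcal{A}}(Z),\quad\text{and}\quad \mathbb{F}_{\mathcal{L}(\mathcal{X})}(\theta(Z)) = \mathbb{F}_{\mathcal{A}}(Z)$$ for all $b_1, b_2 \in \mathcal{B}$ and $Z \in \mathcal{A}$.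
   Context: All algebras are over $\mathbb{C}$. A $\mathcal{B}$-$\mathcal{B}$-non-commutative probability space with a pair of $(\mathcal{B},\mathcal{D})$-valued expectations is a quadruple $(\mathcal{A},\mathbb{E},\mathbb{F},\varepsilon)$ where $\mathcal{A},\mathcal{B},\mathcal{D}$ are unital algebras with $1:=1_{\mathcal{D}}\in\mathcal{B}\subset\mathcal{D}$, $\varepsilon:\mathcal{B}\otimes\mathcal{B}^{\mathrm{op}}\to\mathcal{A}$ is a unital homomorphism whose restrictions to $\mathcal{B}\otimes 1$ and $1\otimes\mathcal{B}^{\mathrm{op}}$ are injective, and $\mathbb{E}:\mathcal{A}\to\mathcal{B}$, $\mathbb{F}:\mathcal{A}\to\mathcal{D}$ are unital linear maps such that, writing $L_b=\varepsilon(b\otimes 1)$ and $R_b=\varepsilon(1\otimes b)$, for all $b_1,b_2,b\in\mathcal{B}$ and $Z\in\mathcal{A}$: $\mathbb{E}(L_{b_1}R_{b_2}Z)=b_1\mathbb{E}(Z)b_2$, $\mathbb{E}(ZL_b)=\mathbb{E}(ZR_b)$, $\mathbb{F}(L_{b_1}R_{b_2}Z)=b_1\mathbb{F}(Z)b_2$, $\mathbb{F}(ZL_b)=\mathbb{F}(ZR_b)$. Its left and right algebras are $\mathcal{A}_\ell=\{Z\in\mathcal{A}: ZR_b=R_bZ\ \forall b\in\mathcal{B}\}$ and $\mathcal{A}_r=\{Z\in\mathcal{A}: ZL_b=L_bZ\ \forall b\in\mathcal{B}\}$. A $\mathcal{B}$-$\mathcal{B}$-bimodule with a pair of specified $(\mathcal{B},\mathcal{D})$-valued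 states is a quadruple $(\mathcal{X},\mathcal{X}^\circ,\mathfrak{p},\mathfrak{q})$ where $\mathcal{B},\mathcal{D}$ are unital algebras with $1:=1_{\mathcal{D}}\in\mathcal{B}\subset\mathcal{D}$, $\mathcal{X}=\mathcal{B}\oplus\mathcal{X}^\circ$ is a direct sum of $\mathcal{B}$-$\mathcal{B}$-bimodules, $\mathfrak{p}:\mathcal{X}\to\mathcal{B}$ is the linear map $\mathfrak{p}(b\oplus\eta)=b$, and $\mathfrak{q}:\mathcal{X}\to\mathcal{D}$ is a linear $\mathcal{B}$-$\mathcal{B}$-bimodule map with $\mathfrak{q}(1\oplus0)=1$. $\mathcal{L}(\mathcal{X})$ denotes the algebra of linear operators on $\mathcal{X}$; for $b\in\mathcal{B}$ the operators $L_b,R_b\in\mathcal{L}(\mathcal{X})$ are $L_b(x)=b\cdot x$, $R_b(x)=x\cdot b$; $\mathcal{L}_\ell(\mathcal{X})=\{Z\in\mathcal{L}(\mathcal{X}): ZR_b=R_bZ\ \forall b\in\mathcal{B}\}$ and $\mathcal{L}_r(\mathcal{X})=\{Z\in\mathcal{L}(\mathcal{X}): ZL_b=L_bZ\ \forall b\in\mathcal{B}\}$. The expectations on $\mathcal{L}(\mathcal{X})$ are $\mathbb{E}_{\mathcal{L}(\mathcal{X})}(Z)=\mathfrak{p}(Z(1\oplus0))$ and $\mathbb{F}_{\mathcal{L}(\mathcal{X})}(Z)=\mathfrak{q}(Z(1\oplus0))$. *)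

theory Defs
  imports "HOL-Algebra.Algebra" "HOL-Algebra.Algebraic_Closure_Type" "HOL-Library.Poly_Mapping"
begin

section \<open>Unital complex algebras\<close>

abbreviation complex_ring :: "complex ring" where
  "complex_ring \<equiv> ring_of_type_algebra"

locale complex_algebra = module complex_ring A + ring A
  for A :: "(complex, 'a, 'm) module_scheme" (structure) +
  assumes smult_mult_left:
      "\<lbrakk>x \<in> carrier A; y \<in> carrier A\<rbrakk> \<Longrightarrow> (c \<odot> x) \<otimes> y = c \<odot> (x \<otimes> y)"
    and smult_mult_right:
      "\<lbrakk>x \<in> carrier A; y \<in> carrier A\<rbrakk> \<Longrightarrow> x \<otimes> (c \<odot> y) = c \<odot> (x \<otimes> y)"

definition linear_maps ::
  "(complex, 'a, 'm) module_scheme \<Rightarrow> (complex, 'b, 'n) module_scheme \<Rightarrow> ('a \<Rightarrow> 'b) set" where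
  "linear_maps V W = {f \<in> hom (add_monoid V) (add_monoid W).
     \<forall>c. \<forall>x\<in>carrier V. f (c \<odot>\<^bsub>V\<^esub> x) = c \<odot>\<^bsub>W\<^esub> f x}"

definition algebra_hom ::
  "(complex, 'a, 'm) module_scheme \<Rightarrow> (complex, 'b, 'n) module_scheme \<Rightarrow> ('a \<Rightarrow> 'b) set" where
  "algebra_hom A C = ring_hom A C \<inter> linear_maps A C"

definition op_algebra :: "(complex, 'a) module \<Rightarrow> (complex, 'a) module" where
  "op_algebra A = A\<lparr>monoid.mult := \<lambda>x y. y \<otimes>\<^bsub>A\<^esub> x\<rparr>"

definition commutant :: "(complex, 'a) module \<Rightarrow> 'a set \<Rightarrow> 'a set" where
  "commutant A S = {Z \<in> carrier A. \<forall>s\<in>S. Z \<otimes>\<^bsub>A\<^esub> s = s \<otimes>\<^bsub>A\<^esub> Z}"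

locale unital_subalgebra = complex_algebra D
  for D :: "(complex, 'd) module" (structure) and B :: "'d set" +
  assumes subring: "subring B D"
    and submodule: "submodule B complex_ring D"

abbreviation sub_algebra :: "(complex, 'd) module \<Rightarrow> 'd set \<Rightarrow> (complex, 'd) module" where
  "sub_algebra D B \<equiv> D\<lparr>carrier := B\<rparr>"


section \<open>Tensor products of algebras\<close>

definition monoid_algebra :: "('g, 'm) monoid_scheme \<Rightarrow> (complex, 'g \<Rightarrow>\<^sub>0 complex) module" where
  "monoid_algebra G =
    \<lparr>carrier = {f. Poly_Mapping.keys f \<subseteq> carrier G},
     monoid.mult = \<lambda>f g. \<Sum>x\<in>Poly_Mapping.keys f. \<Sum>y\<in>Poly_Mapping.keys g.
       Poly_Mapping.single (x \<otimes>\<^bsub>G\<^esub> y) (Poly_Mapping.lookup f x * Poly_Mapping.lookup g y),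
     one = Poly_Mapping.single \<one>\<^bsub>G\<^esub> 1,
     ring.zero = 0,
     ring.add = (+),
     module.smult = \<lambda>c. Poly_Mapping.map ((*) c)\<rparr>"

definition tensor_relations ::
  "(complex, 'a) module \<Rightarrow> (complex, 'b) module \<Rightarrow> ('a \<times> 'b \<Rightarrow>\<^sub>0 complex) set" where
  "tensor_relations A C =
     {Poly_Mapping.single (x \<oplus>\<^bsub>A\<^esub> x', y) 1 - Poly_Mapping.single (x, y) 1
        - Poly_Mapping.single (x', y) 1
        | x x' y. x \<in> carrier A \<and> x' \<in> carrier A \<and> y \<in> carrier C} \<union>
     {Poly_Mapping.single (x, y \<oplus>\<^bsub>C\<^esub> y') 1 - Poly_Mapping.single (x, y) 1
        - Poly_Mapping.single (x, y') 1
        | x y y'. x \<in> carrier A \<and> y \<in> carrier C \<and> y' \<in> carrier C} \<union>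
     {Poly_Mapping.single (c \<odot>\<^bsub>A\<^esub> x, y) 1 - Poly_Mapping.single (x, y) c
        | c x y. x \<in> carrier A \<and> y \<in> carrier C} \<union>
     {Poly_Mapping.single (x, c \<odot>\<^bsub>C\<^esub> y) 1 - Poly_Mapping.single (x, y) c
        | c x y. x \<in> carrier A \<and> y \<in> carrier C}"

text \<open>
  The monoid algebra of the product monoid is the free vector space on the pairs \<open>(x, y)\<close>,
  multiplied by \<open>(x, y) (x', y') = (x x', y y')\<close>.  The linear span of the bilinearity relations
  is stable under left and right multiplication by pairs, so it coincides with the two-sided
  ideal they generate, and the quotient below is the usual algebraic tensor product over the
  complex numbers.
\<close>

definition tensor_ideal ::
  "(complex, 'a) module \<Rightarrow> (complex, 'b) module \<Rightarrow> ('a \<times> 'b \<Rightarrow>\<^sub>0 complex) set" where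
  "tensor_ideal A C = genideal (monoid_algebra (A \<times>\<times> C)) (tensor_relations A C)"

definition tensor_algebra ::
  "(complex, 'a) module \<Rightarrow> (complex, 'b) module \<Rightarrow> (complex, ('a \<times> 'b \<Rightarrow>\<^sub>0 complex) set) module" where
  "tensor_algebra A C = (let M = monoid_algebra (A \<times>\<times> C); I = tensor_ideal A C in
    ring.extend (M Quot I)
      (module.fields (\<lambda>c U. \<Union>u\<in>U. I +>\<^bsub>M\<^esub> (c \<odot>\<^bsub>M\<^esub> u))))"

definition pure_tensor ::
  "(complex, 'a) module \<Rightarrow> (complex, 'b) module \<Rightarrow> 'a \<Rightarrow> 'b \<Rightarrow> ('a \<times> 'b \<Rightarrow>\<^sub>0 complex) set" where
  "pure_tensor A C x y =
    tensor_ideal A C +>\<^bsub>monoid_algebra (A \<times>\<times> C)\<^esub> Poly_Mapping.single (x, y) 1"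


section \<open>Non-commutative probability spaces with a pair of expectations\<close>

definition tensor_B_Bop ::
  "(complex, 'd) module \<Rightarrow> 'd set \<Rightarrow> (complex, ('d \<times> 'd \<Rightarrow>\<^sub>0 complex) set) module" where
  "tensor_B_Bop D B = tensor_algebra (sub_algebra D B) (op_algebra (sub_algebra D B))"

definition pure_B_Bop ::
  "(complex, 'd) module \<Rightarrow> 'd set \<Rightarrow> 'd \<Rightarrow> 'd \<Rightarrow> ('d \<times> 'd \<Rightarrow>\<^sub>0 complex) set" where
  "pure_B_Bop D B = pure_tensor (sub_algebra D B) (op_algebra (sub_algebra D B))"

definition left_elt ::
  "(complex, 'd) module \<Rightarrow> 'd set \<Rightarrow> (('d \<times> 'd \<Rightarrow>\<^sub>0 complex) set \<Rightarrow> 'a) \<Rightarrow> 'd \<Rightarrow> 'a" where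
  "left_elt D B \<epsilon> b = \<epsilon> (pure_B_Bop D B b \<one>\<^bsub>D\<^esub>)"

definition right_elt ::
  "(complex, 'd) module \<Rightarrow> 'd set \<Rightarrow> (('d \<times> 'd \<Rightarrow>\<^sub>0 complex) set \<Rightarrow> 'a) \<Rightarrow> 'd \<Rightarrow> 'a" where
  "right_elt D B \<epsilon> b = \<epsilon> (pure_B_Bop D B \<one>\<^bsub>D\<^esub> b)"

locale ncps_pair_expectations = unital_subalgebra D B + A: complex_algebra A
  for D :: "(complex, 'd) module" and B :: "'d set" and A :: "(complex, 'a) module"
    and E :: "'a \<Rightarrow> 'd" and F :: "'a \<Rightarrow> 'd"
    and \<epsilon> :: "('d \<times> 'd \<Rightarrow>\<^sub>0 complex) set \<Rightarrow> 'a" +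
  assumes eps_hom: "\<epsilon> \<in> algebra_hom (tensor_B_Bop D B) A"
    and eps_inj_left: "inj_on \<epsilon> ((\<lambda>b. pure_B_Bop D B b \<one>\<^bsub>D\<^esub>) ` B)"
    and eps_inj_right: "inj_on \<epsilon> ((\<lambda>b. pure_B_Bop D B \<one>\<^bsub>D\<^esub> b) ` B)"
    and E_linear: "E \<in> linear_maps A (sub_algebra D B)"
    and E_unital: "E \<one>\<^bsub>A\<^esub> = \<one>\<^bsub>D\<^esub>"
    and F_linear: "F \<in> linear_maps A D"
    and F_unital: "F \<one>\<^bsub>A\<^esub> = \<one>\<^bsub>D\<^esub>"
    and E_bimodule: "\<lbrakk>b1 \<in> B; b2 \<in> B; Z \<in> carrier A\<rbrakk> \<Longrightarrow>
      E (left_elt D B \<epsilon> b1 \<otimes>\<^bsub>A\<^esub> right_elt D B \<epsilon> b2 \<otimes>\<^bsub>A\<^esub> Z) = b1 \<otimes>\<^bsub>D\<^esub> E Z \<otimes>\<^bsub>D\<^esub> b2"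
    and E_left_right: "\<lbrakk>b \<in> B; Z \<in> carrier A\<rbrakk> \<Longrightarrow>
      E (Z \<otimes>\<^bsub>A\<^esub> left_elt D B \<epsilon> b) = E (Z \<otimes>\<^bsub>A\<^esub> right_elt D B \<epsilon> b)"
    and F_bimodule: "\<lbrakk>b1 \<in> B; b2 \<in> B; Z \<in> carrier A\<rbrakk> \<Longrightarrow>
      F (left_elt D B \<epsilon> b1 \<otimes>\<^bsub>A\<^esub> right_elt D B \<epsilon> b2 \<otimes>\<^bsub>A\<^esub> Z) = b1 \<otimes>\<^bsub>D\<^esub> F Z \<otimes>\<^bsub>D\<^esub> b2"
    and F_left_right: "\<lbrakk>b \<in> B; Z \<in> carrier A\<rbrakk> \<Longrightarrow>
      F (Z \<otimes>\<^bsub>A\<^esub> left_elt D B \<epsilon> b) = F (Z \<otimes>\<^bsub>A\<^esub> right_elt D B \<epsilon> b)"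

definition left_algebra ::
  "(complex, 'd) module \<Rightarrow> 'd set \<Rightarrow> (complex, 'a) module
     \<Rightarrow> (('d \<times> 'd \<Rightarrow>\<^sub>0 complex) set \<Rightarrow> 'a) \<Rightarrow> 'a set" where
  "left_algebra D B A \<epsilon> = commutant A (right_elt D B \<epsilon> ` B)"

definition right_algebra ::
  "(complex, 'd) module \<Rightarrow> 'd set \<Rightarrow> (complex, 'a) module
     \<Rightarrow> (('d \<times> 'd \<Rightarrow>\<^sub>0 complex) set \<Rightarrow> 'a) \<Rightarrow> 'a set" where
  "right_algebra D B A \<epsilon> = commutant A (left_elt D B \<epsilon> ` B)"


section \<open>Bimodules with a pair of specified states\<close>

text \<open>As for modules, the fields \<open>mult\<close> and \<open>one\<close> inherited from rings carry no meaning
  in a bimodule.\<close>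

record ('b, 'x) bimodule = "(complex, 'x) module" +
  lact :: "'b \<Rightarrow> 'x \<Rightarrow> 'x"
  ract :: "'x \<Rightarrow> 'b \<Rightarrow> 'x"

locale bimodule = B: complex_algebra B + \<XX>: module complex_ring \<XX>
  for B :: "(complex, 'b) module" and \<XX> :: "('b, 'x) bimodule" +
  assumes lact_closed: "\<lbrakk>b \<in> carrier B; x \<in> carrier \<XX>\<rbrakk> \<Longrightarrow> lact \<XX> b x \<in> carrier \<XX>"
    and ract_closed: "\<lbrakk>x \<in> carrier \<XX>; b \<in> carrier B\<rbrakk> \<Longrightarrow> ract \<XX> x b \<in> carrier \<XX>"
    and lact_linear: "b \<in> carrier B \<Longrightarrow> (\<lambda>x. lact \<XX> b x) \<in> linear_maps \<XX> \<XX>"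
    and lact_linear_scalar: "x \<in> carrier \<XX> \<Longrightarrow> (\<lambda>b. lact \<XX> b x) \<in> linear_maps B \<XX>"
    and ract_linear: "b \<in> carrier B \<Longrightarrow> (\<lambda>x. ract \<XX> x b) \<in> linear_maps \<XX> \<XX>"
    and ract_linear_scalar: "x \<in> carrier \<XX> \<Longrightarrow> (\<lambda>b. ract \<XX> x b) \<in> linear_maps B \<XX>"
    and lact_one: "x \<in> carrier \<XX> \<Longrightarrow> lact \<XX> \<one>\<^bsub>B\<^esub> x = x"
    and ract_one: "x \<in> carrier \<XX> \<Longrightarrow> ract \<XX> x \<one>\<^bsub>B\<^esub> = x"
    and lact_mult: "\<lbrakk>a \<in> carrier B; b \<in> carrier B; x \<in> carrier \<XX>\<rbrakk> \<Longrightarrow>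
      lact \<XX> (a \<otimes>\<^bsub>B\<^esub> b) x = lact \<XX> a (lact \<XX> b x)"
    and ract_mult: "\<lbrakk>a \<in> carrier B; b \<in> carrier B; x \<in> carrier \<XX>\<rbrakk> \<Longrightarrow>
      ract \<XX> x (a \<otimes>\<^bsub>B\<^esub> b) = ract \<XX> (ract \<XX> x a) b"
    and lact_ract: "\<lbrakk>a \<in> carrier B; b \<in> carrier B; x \<in> carrier \<XX>\<rbrakk> \<Longrightarrow>
      ract \<XX> (lact \<XX> a x) b = lact \<XX> a (ract \<XX> x b)"

definition regular_bimodule :: "(complex, 'b) module \<Rightarrow> ('b, 'b) bimodule" where
  "regular_bimodule B = module.extend B (bimodule.fields (monoid.mult B) (monoid.mult B))"

definition bimodule_sum ::
  "('b, 'x) bimodule \<Rightarrow> ('b, 'y) bimodule \<Rightarrow> ('b, 'x \<times> 'y) bimodule" where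
  "bimodule_sum \<XX> Y =
    \<lparr>carrier = carrier \<XX> \<times> carrier Y,
     monoid.mult = undefined,
     one = undefined,
     ring.zero = (\<zero>\<^bsub>\<XX>\<^esub>, \<zero>\<^bsub>Y\<^esub>),
     ring.add = \<lambda>(x, y) (x', y'). (x \<oplus>\<^bsub>\<XX>\<^esub> x', y \<oplus>\<^bsub>Y\<^esub> y'),
     module.smult = \<lambda>c (x, y). (c \<odot>\<^bsub>\<XX>\<^esub> x, c \<odot>\<^bsub>Y\<^esub> y),
     lact = \<lambda>b (x, y). (lact \<XX> b x, lact Y b y),
     ract = \<lambda>(x, y) b. (ract \<XX> x b, ract Y y b)\<rparr>"

locale bimodule_specified_states =
  unital_subalgebra D B + \<XX>\<^sub>0: bimodule "sub_algebra D B" \<XX>\<^sub>0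
  for D :: "(complex, 'd) module" and B :: "'d set"
    and \<XX> :: "('d, 'd \<times> 'x) bimodule" and \<XX>\<^sub>0 :: "('d, 'x) bimodule"
    and p :: "'d \<times> 'x \<Rightarrow> 'd" and q :: "'d \<times> 'x \<Rightarrow> 'd" +
  assumes X_sum: "\<XX> = bimodule_sum (regular_bimodule (sub_algebra D B)) \<XX>\<^sub>0"
    and p_proj: "\<lbrakk>b \<in> B; \<eta> \<in> carrier \<XX>\<^sub>0\<rbrakk> \<Longrightarrow> p (b, \<eta>) = b"
    and q_linear: "q \<in> linear_maps \<XX> D"
    and q_lact: "\<lbrakk>b \<in> B; x \<in> carrier \<XX>\<rbrakk> \<Longrightarrow> q (lact \<XX> b x) = b \<otimes>\<^bsub>D\<^esub> q x"
    and q_ract: "\<lbrakk>b \<in> B; x \<in> carrier \<XX>\<rbrakk> \<Longrightarrow> q (ract \<XX> x b) = q x \<otimes>\<^bsub>D\<^esub> b"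
    and q_unital: "q (\<one>\<^bsub>D\<^esub>, \<zero>\<^bsub>\<XX>\<^sub>0\<^esub>) = \<one>\<^bsub>D\<^esub>"

text \<open>Operators are made extensional (undefined off the carrier), so that equality of operators
  is equality on the carrier.\<close>

definition linear_operators :: "('b, 'x) bimodule \<Rightarrow> (complex, 'x \<Rightarrow> 'x) module" where
  "linear_operators \<XX> =
    \<lparr>carrier = linear_maps \<XX> \<XX> \<inter> extensional (carrier \<XX>),
     monoid.mult = \<lambda>S T. compose (carrier \<XX>) S T,
     one = \<lambda>x\<in>carrier \<XX>. x,
     ring.zero = \<lambda>x\<in>carrier \<XX>. \<zero>\<^bsub>\<XX>\<^esub>,
     ring.add = \<lambda>S T. \<lambda>x\<in>carrier \<XX>. S x \<oplus>\<^bsub>\<XX>\<^esub> T x,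
     module.smult = \<lambda>c T. \<lambda>x\<in>carrier \<XX>. c \<odot>\<^bsub>\<XX>\<^esub> T x\<rparr>"

definition left_op :: "('b, 'x) bimodule \<Rightarrow> 'b \<Rightarrow> 'x \<Rightarrow> 'x" where
  "left_op \<XX> b = (\<lambda>x\<in>carrier \<XX>. lact \<XX> b x)"

definition right_op :: "('b, 'x) bimodule \<Rightarrow> 'b \<Rightarrow> 'x \<Rightarrow> 'x" where
  "right_op \<XX> b = (\<lambda>x\<in>carrier \<XX>. ract \<XX> x b)"

definition left_operators :: "'b set \<Rightarrow> ('b, 'x) bimodule \<Rightarrow> ('x \<Rightarrow> 'x) set" where
  "left_operators B \<XX> = commutant (linear_operators \<XX>) (right_op \<XX> ` B)"

definition right_operators :: "'b set \<Rightarrow> ('b, 'x) bimodule \<Rightarrow> ('x \<Rightarrow> 'x) set" where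
  "right_operators B \<XX> = commutant (linear_operators \<XX>) (left_op \<XX> ` B)"

text \<open>With \<open>p\<close> or \<open>q\<close> for \<open>s\<close>, this gives the two expectations on the algebra of operators.\<close>

definition operator_expectation ::
  "(complex, 'd) module \<Rightarrow> ('d, 'x) bimodule \<Rightarrow> ('d \<times> 'x \<Rightarrow> 'd) \<Rightarrow> ('d \<times> 'x \<Rightarrow> 'd \<times> 'x) \<Rightarrow> 'd" where
  "operator_expectation D \<XX>\<^sub>0 s Z = s (Z (\<one>\<^bsub>D\<^esub>, \<zero>\<^bsub>\<XX>\<^sub>0\<^esub>))"

end

theory Submission
  imports Defs
begin

text \<open>
  Write \<open>L b\<close> and \<open>R' b\<close> for the images of \<open>b \<otimes> 1\<close> and \<open>1 \<otimes> b\<close> in \<open>A\<close>.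
  Let \<open>N\<close> be the largest left ideal of \<open>A\<close> contained in the kernels of \<open>E\<close> and \<open>F\<close>.  Since
  \<open>E\<close> and \<open>F\<close> do not distinguish \<open>Z (L b)\<close> from \<open>Z (R' b)\<close>, all elements \<open>Z (L b - R' b)\<close> lie in
  \<open>N\<close>.  The left \<open>A\<close>-module \<open>A / N\<close> is a \<open>B\<close>-\<open>B\<close>-bimodule under multiplication by
  \<open>L b\<close> and \<open>R' b\<close>, both expectations descend to it, and \<open>b \<mapsto> [L b]\<close> is a bimodule map
  splitting \<open>E\<close>, so that \<open>A / N = B \<oplus> ker E / N\<close>.  The representation is left multiplication,
  with the class of the unit as the vector \<open>1 \<oplus> 0\<close>.
\<close>

section \<open>Monoid algebras and tensor products\<close>

lemma carrier_complex_ring [simp]: "carrier complex_ring = UNIV"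
  by (simp add: ring_of_type_algebra_def)

lemma monoid_algebra_simps [simp]:
  "f \<in> carrier (monoid_algebra G) \<longleftrightarrow> Poly_Mapping.keys f \<subseteq> carrier G"
  "\<one>\<^bsub>monoid_algebra G\<^esub> = Poly_Mapping.single \<one>\<^bsub>G\<^esub> 1"
  "\<zero>\<^bsub>monoid_algebra G\<^esub> = 0"
  "f \<oplus>\<^bsub>monoid_algebra G\<^esub> g = f + g"
  "c \<odot>\<^bsub>monoid_algebra G\<^esub> f = Poly_Mapping.map ((*) c) f"
  by (simp_all add: monoid_algebra_def)

text \<open>The product is defined as a sum over the supports of its factors, and supports change
  under addition. Padding with zero coefficients puts several products over common finite index
  sets, so that distributivity becomes a termwise statement.\<close>

lemma monoid_algebra_mult_superset:
  assumes "finite S" "finite T" "Poly_Mapping.keys f \<subseteq> S" "Poly_Mapping.keys g \<subseteq> T"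
  shows "f \<otimes>\<^bsub>monoid_algebra G\<^esub> g = (\<Sum>x\<in>S. \<Sum>y\<in>T.
    Poly_Mapping.single (x \<otimes>\<^bsub>G\<^esub> y) (Poly_Mapping.lookup f x * Poly_Mapping.lookup g y))"
proof -
  have "(\<Sum>y\<in>Poly_Mapping.keys g.
        Poly_Mapping.single (x \<otimes>\<^bsub>G\<^esub> y) (Poly_Mapping.lookup f x * Poly_Mapping.lookup g y)) =
      (\<Sum>y\<in>T. Poly_Mapping.single (x \<otimes>\<^bsub>G\<^esub> y) (Poly_Mapping.lookup f x * Poly_Mapping.lookup g y))" for x
    by (rule sum.mono_neutral_left) (use assms in \<open>auto simp: in_keys_iff\<close>)
  then have "f \<otimes>\<^bsub>monoid_algebra G\<^esub> g = (\<Sum>x\<in>Poly_Mapping.keys f. \<Sum>y\<in>T.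
      Poly_Mapping.single (x \<otimes>\<^bsub>G\<^esub> y) (Poly_Mapping.lookup f x * Poly_Mapping.lookup g y))"
    by (simp add: monoid_algebra_def)
  also have "\<dots> = (\<Sum>x\<in>S. \<Sum>y\<in>T.
      Poly_Mapping.single (x \<otimes>\<^bsub>G\<^esub> y) (Poly_Mapping.lookup f x * Poly_Mapping.lookup g y))"
    by (rule sum.mono_neutral_left) (use assms in \<open>auto simp: in_keys_iff\<close>)
  finally show ?thesis .
qed

lemma monoid_algebra_mult_single:
  "Poly_Mapping.single x a \<otimes>\<^bsub>monoid_algebra G\<^esub> Poly_Mapping.single y b =
    Poly_Mapping.single (x \<otimes>\<^bsub>G\<^esub> y) (a * b)"
  by (subst monoid_algebra_mult_superset[of "{x}" "{y}"]) auto

lemma monoid_algebra_l_distr: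
  "(f + g) \<otimes>\<^bsub>monoid_algebra G\<^esub> h = f \<otimes>\<^bsub>monoid_algebra G\<^esub> h + g \<otimes>\<^bsub>monoid_algebra G\<^esub> h"
  using monoid_algebra_mult_superset
    [of "Poly_Mapping.keys f \<union> Poly_Mapping.keys g" "Poly_Mapping.keys h" _ h G] keys_add[of f g]
  by (simp add: lookup_add ring_distribs single_add sum.distrib)

lemma monoid_algebra_r_distr:
  "h \<otimes>\<^bsub>monoid_algebra G\<^esub> (f + g) = h \<otimes>\<^bsub>monoid_algebra G\<^esub> f + h \<otimes>\<^bsub>monoid_algebra G\<^esub> g"
  using monoid_algebra_mult_superset
    [of "Poly_Mapping.keys h" "Poly_Mapping.keys f \<union> Poly_Mapping.keys g" h _ G] keys_add[of f g]
  by (simp add: lookup_add ring_distribs single_add sum.distrib)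

lemma monoid_algebra_mult_zero:
  "0 \<otimes>\<^bsub>monoid_algebra G\<^esub> f = 0" "f \<otimes>\<^bsub>monoid_algebra G\<^esub> 0 = 0"
  by (simp_all add: monoid_algebra_def)

text \<open>A finitely supported function is the finite sum of its one-point parts. Identities that
  are additive in each argument thereby reduce to generators, where they are laws of
  \<open>G\<close>.\<close>

lemma monoid_algebra_induct [consumes 1, case_names zero single add]:
  assumes f: "f \<in> carrier (monoid_algebra G)"
    and zero: "P 0"
    and single: "\<And>x a. x \<in> carrier G \<Longrightarrow> P (Poly_Mapping.single x a)"
    and add: "\<And>f g. P f \<Longrightarrow> P g \<Longrightarrow> P (f + g)"
  shows "P f"
proof -
  have "P (\<Sum>x\<in>S. Poly_Mapping.single x (Poly_Mapping.lookup f x))"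
    if "finite S" "S \<subseteq> carrier G" for S
    using that by (induction S) (auto intro: zero single add)
  moreover have "f = (\<Sum>x\<in>Poly_Mapping.keys f. Poly_Mapping.single x (Poly_Mapping.lookup f x))"
    by (rule poly_mapping_eqI)
      (auto simp: lookup_sum lookup_single when_def in_keys_iff sum.delta)
  ultimately show ?thesis
    using f by (metis finite_keys monoid_algebra_simps(1))
qed

text \<open>Expressing scaling as a ring multiplication makes every ideal stable under scalars,
  although \<open>genideal\<close> refers to the ring structure only.\<close>

lemma monoid_algebra_smult_eq_mult:
  assumes "monoid G" "f \<in> carrier (monoid_algebra G)"
  shows "c \<odot>\<^bsub>monoid_algebra G\<^esub> f = Poly_Mapping.single \<one>\<^bsub>G\<^esub> c \<otimes>\<^bsub>monoid_algebra G\<^esub> f"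
proof -
  interpret monoid G by fact
  have map_add: "Poly_Mapping.map ((*) c) (g + h) =
      Poly_Mapping.map ((*) c) g + Poly_Mapping.map ((*) c) h" for g h :: "'a \<Rightarrow>\<^sub>0 complex"
    by (rule poly_mapping_eqI) (simp add: lookup_add map.rep_eq when_def flip: ring_distribs)
  have map_zero: "Poly_Mapping.map ((*) c) (0 :: 'a \<Rightarrow>\<^sub>0 complex) = 0"
    by (rule poly_mapping_eqI) (simp add: map.rep_eq when_def)
  from assms(2) show ?thesis
    by (induction rule: monoid_algebra_induct)
      (simp_all add: monoid_algebra_mult_zero monoid_algebra_mult_single map_add map_zero
        monoid_algebra_r_distr)
qed

text \<open>Nested induction over the factors leaves only products of one-point functions, for which
  closure and associativity come from \<open>G\<close> and from the complex numbers.\<close>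

lemma monoid_algebra_ring:
  assumes "monoid G"
  shows "ring (monoid_algebra G)"
proof -
  interpret monoid G by fact
  let ?M = "monoid_algebra G"
  have closed: "f \<otimes>\<^bsub>?M\<^esub> g \<in> carrier ?M" if "f \<in> carrier ?M" "g \<in> carrier ?M" for f g
    using that(1)
  proof (induction rule: monoid_algebra_induct)
    case (single x a)
    from that(2) show ?case
    proof (induction rule: monoid_algebra_induct)
      case (add f g)
      then show ?case
        using keys_add[of "Poly_Mapping.single x a \<otimes>\<^bsub>?M\<^esub> f" "Poly_Mapping.single x a \<otimes>\<^bsub>?M\<^esub> g"]
        by (auto simp: monoid_algebra_r_distr)
    qed (use single in \<open>auto simp: monoid_algebra_mult_zero monoid_algebra_mult_single\<close>)
  next
    case (add f h)
    then show ?case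
      using keys_add[of "f \<otimes>\<^bsub>?M\<^esub> g" "h \<otimes>\<^bsub>?M\<^esub> g"] by (auto simp: monoid_algebra_l_distr)
  qed (simp add: monoid_algebra_mult_zero)
  have assoc: "(f \<otimes>\<^bsub>?M\<^esub> g) \<otimes>\<^bsub>?M\<^esub> h = f \<otimes>\<^bsub>?M\<^esub> (g \<otimes>\<^bsub>?M\<^esub> h)"
    if "f \<in> carrier ?M" "g \<in> carrier ?M" "h \<in> carrier ?M" for f g h
    using that(1)
  proof (induction rule: monoid_algebra_induct)
    case (single x a)
    from that(2) show ?case
    proof (induction rule: monoid_algebra_induct)
      case (single y b)
      from that(3) show ?case
        by (induction rule: monoid_algebra_induct)
          (use single \<open>x \<in> carrier G\<close> in
            \<open>simp_all add: monoid_algebra_mult_zero monoid_algebra_mult_single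
              monoid_algebra_r_distr m_assoc mult.assoc\<close>)
    qed (simp_all add: monoid_algebra_mult_zero monoid_algebra_r_distr monoid_algebra_l_distr)
  qed (simp_all add: monoid_algebra_mult_zero monoid_algebra_l_distr)
  have one: "\<one>\<^bsub>?M\<^esub> \<otimes>\<^bsub>?M\<^esub> f = f" "f \<otimes>\<^bsub>?M\<^esub> \<one>\<^bsub>?M\<^esub> = f" if "f \<in> carrier ?M" for f
    using that by (induction rule: monoid_algebra_induct)
      (simp_all add: monoid_algebra_mult_zero monoid_algebra_mult_single
        monoid_algebra_r_distr monoid_algebra_l_distr)
  show ?thesis
  proof (rule ringI)
    show "abelian_group ?M"
    proof (rule abelian_groupI)
      fix f assume "f \<in> carrier ?M"
      then show "\<exists>g\<in>carrier ?M. g \<oplus>\<^bsub>?M\<^esub> f = \<zero>\<^bsub>?M\<^esub>"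
        by (intro bexI[of _ "- f"]) auto
    qed (use keys_add in \<open>fastforce simp: ac_simps\<close>)+
    show "monoid ?M"
      by (rule monoidI) (use closed assoc one in \<open>simp_all\<close>)
  qed (simp_all add: monoid_algebra_l_distr monoid_algebra_r_distr)
qed

section \<open>Working rules for linear maps and operators\<close>

lemma linear_mapsD:
  assumes "f \<in> linear_maps V W"
  shows "x \<in> carrier V \<Longrightarrow> f x \<in> carrier W"
    and "x \<in> carrier V \<Longrightarrow> y \<in> carrier V \<Longrightarrow> f (x \<oplus>\<^bsub>V\<^esub> y) = f x \<oplus>\<^bsub>W\<^esub> f y"
    and "x \<in> carrier V \<Longrightarrow> f (c \<odot>\<^bsub>V\<^esub> x) = c \<odot>\<^bsub>W\<^esub> f x"
  using assms by (auto simp: linear_maps_def hom_def)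

lemma linear_mapsI:
  assumes "\<And>x. x \<in> carrier V \<Longrightarrow> f x \<in> carrier W"
    and "\<And>x y. x \<in> carrier V \<Longrightarrow> y \<in> carrier V \<Longrightarrow> f (x \<oplus>\<^bsub>V\<^esub> y) = f x \<oplus>\<^bsub>W\<^esub> f y"
    and "\<And>c x. x \<in> carrier V \<Longrightarrow> f (c \<odot>\<^bsub>V\<^esub> x) = c \<odot>\<^bsub>W\<^esub> f x"
  shows "f \<in> linear_maps V W"
  using assms by (auto simp: linear_maps_def hom_def)

lemma linear_operators_simps:
  "carrier (linear_operators \<XX>) = linear_maps \<XX> \<XX> \<inter> extensional (carrier \<XX>)"
  "S \<otimes>\<^bsub>linear_operators \<XX>\<^esub> T = compose (carrier \<XX>) S T"
  "\<one>\<^bsub>linear_operators \<XX>\<^esub> = (\<lambda>x\<in>carrier \<XX>. x)"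
  "S \<oplus>\<^bsub>linear_operators \<XX>\<^esub> T = (\<lambda>x\<in>carrier \<XX>. S x \<oplus>\<^bsub>\<XX>\<^esub> T x)"
  "c \<odot>\<^bsub>linear_operators \<XX>\<^esub> T = (\<lambda>x\<in>carrier \<XX>. c \<odot>\<^bsub>\<XX>\<^esub> T x)"
  by (simp_all add: linear_operators_def)

section \<open>Bilinearity and multiplication of pure tensors\<close>

lemma tensor_algebra_simps:
  "carrier (tensor_algebra A C) = a_rcosets\<^bsub>monoid_algebra (A \<times>\<times> C)\<^esub> tensor_ideal A C"
  "U \<otimes>\<^bsub>tensor_algebra A C\<^esub> V = rcoset_mult (monoid_algebra (A \<times>\<times> C)) (tensor_ideal A C) U V"
  "\<one>\<^bsub>tensor_algebra A C\<^esub> =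
    tensor_ideal A C +>\<^bsub>monoid_algebra (A \<times>\<times> C)\<^esub> \<one>\<^bsub>monoid_algebra (A \<times>\<times> C)\<^esub>"
  "U \<oplus>\<^bsub>tensor_algebra A C\<^esub> V = set_add (monoid_algebra (A \<times>\<times> C)) U V"
  "c \<odot>\<^bsub>tensor_algebra A C\<^esub> U = (\<Union>u\<in>U. tensor_ideal A C +>\<^bsub>monoid_algebra (A \<times>\<times> C)\<^esub>
    (c \<odot>\<^bsub>monoid_algebra (A \<times>\<times> C)\<^esub> u))"
  by (simp_all add: tensor_algebra_def Let_def FactRing_def ring.defs module.defs)

context
  fixes A :: "(complex, 'a) module" and C :: "(complex, 'b) module"
  assumes A: "complex_algebra A" and C: "complex_algebra C"
begin

interpretation A: complex_algebra A by (rule A)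
interpretation C: complex_algebra C by (rule C)
interpretation AC: monoid "A \<times>\<times> C"
  by (rule DirProd_monoid) (rule A.is_monoid C.is_monoid)+
interpretation M: ring "monoid_algebra (A \<times>\<times> C)"
  by (rule monoid_algebra_ring) (rule AC.monoid_axioms)

text \<open>The library facts that \<open>genideal\<close> is an ideal and contains its generators
  ask for generators inside the carrier. This holds because \<open>A\<close> and \<open>C\<close>
  are closed under addition and scaling.\<close>

lemma tensor_relations_subset:
  "tensor_relations A C \<subseteq> carrier (monoid_algebra (A \<times>\<times> C))"
proof
  fix f assume "f \<in> tensor_relations A C"
  then have "Poly_Mapping.keys f \<subseteq> carrier A \<times> carrier C"
    unfolding tensor_relations_def
    by (auto dest!: set_mp[OF keys_diff] split: if_splits)
  then show "f \<in> carrier (monoid_algebra (A \<times>\<times> C))" by simp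
qed

interpretation I: ideal "tensor_ideal A C" "monoid_algebra (A \<times>\<times> C)"
  unfolding tensor_ideal_def by (rule M.genideal_ideal) (rule tensor_relations_subset)

text \<open>Writing \<open>f\<close> as \<open>(f - g) + g\<close> places it in the coset of
  \<open>g\<close>. The subtraction is that of finitely supported functions, as in
  \<open>tensor_relations\<close>, and not the ring subtraction of the record.\<close>

lemma tensor_coset_eqI:
  assumes "f \<in> carrier (monoid_algebra (A \<times>\<times> C))" "g \<in> carrier (monoid_algebra (A \<times>\<times> C))"
    "f - g \<in> tensor_ideal A C"
  shows "tensor_ideal A C +>\<^bsub>monoid_algebra (A \<times>\<times> C)\<^esub> f =
    tensor_ideal A C +>\<^bsub>monoid_algebra (A \<times>\<times> C)\<^esub> g"
proof -
  have "f \<in> tensor_ideal A C +>\<^bsub>monoid_algebra (A \<times>\<times> C)\<^esub> g"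
    using assms(3) by (force simp: a_r_coset_def')
  then show ?thesis
    using I.a_repr_independence' assms(2) by metis
qed

lemma tensor_relations_in_ideal:
  "f \<in> tensor_relations A C \<Longrightarrow> f \<in> tensor_ideal A C"
  unfolding tensor_ideal_def using M.genideal_self tensor_relations_subset by blast

lemma pure_tensor_closed:
  "\<lbrakk>x \<in> carrier A; y \<in> carrier C\<rbrakk> \<Longrightarrow> pure_tensor A C x y \<in> carrier (tensor_algebra A C)"
  unfolding pure_tensor_def tensor_algebra_simps
  by (rule M.a_rcosetsI) (use I.a_subset in auto)

lemma pure_tensor_one: "\<one>\<^bsub>tensor_algebra A C\<^esub> = pure_tensor A C \<one>\<^bsub>A\<^esub> \<one>\<^bsub>C\<^esub>"
  by (simp add: pure_tensor_def tensor_algebra_simps)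

lemma pure_tensor_mult:
  assumes "x \<in> carrier A" "y \<in> carrier C" "x' \<in> carrier A" "y' \<in> carrier C"
  shows "pure_tensor A C x y \<otimes>\<^bsub>tensor_algebra A C\<^esub> pure_tensor A C x' y' =
    pure_tensor A C (x \<otimes>\<^bsub>A\<^esub> x') (y \<otimes>\<^bsub>C\<^esub> y')"
  using assms
  by (simp add: pure_tensor_def tensor_algebra_simps I.rcoset_mult_add monoid_algebra_mult_single)

lemma pure_tensor_add_left:
  assumes "x \<in> carrier A" "x' \<in> carrier A" "y \<in> carrier C"
  shows "pure_tensor A C (x \<oplus>\<^bsub>A\<^esub> x') y =
    pure_tensor A C x y \<oplus>\<^bsub>tensor_algebra A C\<^esub> pure_tensor A C x' y"
proof -
  have "Poly_Mapping.single (x \<oplus>\<^bsub>A\<^esub> x', y) 1 -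
      (Poly_Mapping.single (x, y) 1 + Poly_Mapping.single (x', y) 1) \<in> tensor_ideal A C"
    \<comment> \<open>\<open>diff_diff_eq\<close> matches the grouped subtrahend with the two
      successive subtractions in \<open>tensor_relations\<close>.\<close>
    by (rule tensor_relations_in_ideal)
      (use assms in \<open>unfold tensor_relations_def, simp add: diff_diff_eq, blast\<close>)
  then show ?thesis
    unfolding pure_tensor_def tensor_algebra_simps
    using assms I.a_rcos_sum[of "Poly_Mapping.single (x, y) 1" "Poly_Mapping.single (x', y) 1"]
      M.a_closed[of "Poly_Mapping.single (x, y) 1" "Poly_Mapping.single (x', y) 1"]
    by (simp add: tensor_coset_eqI)
qed

lemma pure_tensor_add_right:
  assumes "x \<in> carrier A" "y \<in> carrier C" "y' \<in> carrier C"
  shows "pure_tensor A C x (y \<oplus>\<^bsub>C\<^esub> y') =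
    pure_tensor A C x y \<oplus>\<^bsub>tensor_algebra A C\<^esub> pure_tensor A C x y'"
proof -
  have "Poly_Mapping.single (x, y \<oplus>\<^bsub>C\<^esub> y') 1 -
      (Poly_Mapping.single (x, y) 1 + Poly_Mapping.single (x, y') 1) \<in> tensor_ideal A C"
    by (rule tensor_relations_in_ideal)
      (use assms in \<open>unfold tensor_relations_def, simp add: diff_diff_eq, blast\<close>)
  then show ?thesis
    unfolding pure_tensor_def tensor_algebra_simps
    using assms I.a_rcos_sum[of "Poly_Mapping.single (x, y) 1" "Poly_Mapping.single (x, y') 1"]
      M.a_closed[of "Poly_Mapping.single (x, y) 1" "Poly_Mapping.single (x, y') 1"]
    by (simp add: tensor_coset_eqI)
qed

text \<open>The scalar action on the quotient is a union over all representatives of a coset. Two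
  representatives differ by an element of the ideal, which absorbs multiplication by the scaled
  unit, so all members of the union coincide.\<close>

lemma tensor_smult_coset:
  assumes f: "f \<in> carrier (monoid_algebra (A \<times>\<times> C))"
  shows "c \<odot>\<^bsub>tensor_algebra A C\<^esub> (tensor_ideal A C +>\<^bsub>monoid_algebra (A \<times>\<times> C)\<^esub> f) =
    tensor_ideal A C +>\<^bsub>monoid_algebra (A \<times>\<times> C)\<^esub> (c \<odot>\<^bsub>monoid_algebra (A \<times>\<times> C)\<^esub> f)"
proof -
  let ?M = "monoid_algebra (A \<times>\<times> C)" and ?I = "tensor_ideal A C"
  let ?c = "Poly_Mapping.single \<one>\<^bsub>A \<times>\<times> C\<^esub> c"
  have c: "?c \<in> carrier ?M" by simp
  have smult: "c \<odot>\<^bsub>?M\<^esub> g = ?c \<otimes>\<^bsub>?M\<^esub> g" if "g \<in> carrier ?M" for g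
    using monoid_algebra_smult_eq_mult[OF AC.monoid_axioms that] .
  have "?I +>\<^bsub>?M\<^esub> (c \<odot>\<^bsub>?M\<^esub> u) = ?I +>\<^bsub>?M\<^esub> (c \<odot>\<^bsub>?M\<^esub> f)" if u: "u \<in> ?I +>\<^bsub>?M\<^esub> f" for u
  proof -
    from u obtain i where i: "i \<in> ?I" "u = i + f"
      by (auto simp: a_r_coset_def')
    have iM: "i \<in> carrier ?M" using i(1) by (rule I.a_Hcarr)
    have uM: "u \<in> carrier ?M"
      using M.a_closed[OF iM f] i(2) by simp
    have "?c \<otimes>\<^bsub>?M\<^esub> u = ?c \<otimes>\<^bsub>?M\<^esub> i + ?c \<otimes>\<^bsub>?M\<^esub> f"
      unfolding i(2) by (rule monoid_algebra_r_distr)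
    then have "c \<odot>\<^bsub>?M\<^esub> u - c \<odot>\<^bsub>?M\<^esub> f = ?c \<otimes>\<^bsub>?M\<^esub> i"
      unfolding smult[OF uM] smult[OF f] by (metis add_diff_cancel_right')
    then have "c \<odot>\<^bsub>?M\<^esub> u - c \<odot>\<^bsub>?M\<^esub> f \<in> ?I"
      using I.I_l_closed[OF i(1) c] by simp
    moreover have "c \<odot>\<^bsub>?M\<^esub> u \<in> carrier ?M" "c \<odot>\<^bsub>?M\<^esub> f \<in> carrier ?M"
      unfolding smult[OF uM] smult[OF f] using c uM f by (blast intro: M.m_closed)+
    ultimately show ?thesis
      using tensor_coset_eqI by blast
  qed
  \<comment> \<open>The coset is nonempty, so the union of equal cosets is that coset and not the
    empty set.\<close>
  moreover have "f \<in> ?I +>\<^bsub>?M\<^esub> f"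
    using I.a_rcos_self f by blast
  ultimately show ?thesis
    unfolding tensor_algebra_simps by blast
qed

text \<open>The scaling relation produces the generator with coefficient \<open>c\<close>, which is
  \<open>c\<close> times the generator with coefficient 1; \<open>tensor_smult_coset\<close> moves
  this scalar out of the coset.\<close>

lemma pure_tensor_smult_left:
  assumes "x \<in> carrier A" "y \<in> carrier C"
  shows "pure_tensor A C (c \<odot>\<^bsub>A\<^esub> x) y = c \<odot>\<^bsub>tensor_algebra A C\<^esub> pure_tensor A C x y"
proof -
  have "Poly_Mapping.single (c \<odot>\<^bsub>A\<^esub> x, y) 1 - Poly_Mapping.single (x, y) c \<in> tensor_ideal A C"
    by (rule tensor_relations_in_ideal) (use assms in \<open>unfold tensor_relations_def, blast\<close>)
  then have "pure_tensor A C (c \<odot>\<^bsub>A\<^esub> x) y =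
      tensor_ideal A C +>\<^bsub>monoid_algebra (A \<times>\<times> C)\<^esub> Poly_Mapping.single (x, y) c"
    unfolding pure_tensor_def using assms by (intro tensor_coset_eqI) auto
  then show ?thesis
    using assms by (simp add: pure_tensor_def tensor_smult_coset)
qed

lemma pure_tensor_smult_right:
  assumes "x \<in> carrier A" "y \<in> carrier C"
  shows "pure_tensor A C x (c \<odot>\<^bsub>C\<^esub> y) = c \<odot>\<^bsub>tensor_algebra A C\<^esub> pure_tensor A C x y"
proof -
  have "Poly_Mapping.single (x, c \<odot>\<^bsub>C\<^esub> y) 1 - Poly_Mapping.single (x, y) c \<in> tensor_ideal A C"
    by (rule tensor_relations_in_ideal) (use assms in \<open>unfold tensor_relations_def, blast\<close>)
  then have "pure_tensor A C x (c \<odot>\<^bsub>C\<^esub> y) =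
      tensor_ideal A C +>\<^bsub>monoid_algebra (A \<times>\<times> C)\<^esub> Poly_Mapping.single (x, y) c"
    unfolding pure_tensor_def using assms by (intro tensor_coset_eqI) auto
  then show ?thesis
    using assms by (simp add: pure_tensor_def tensor_smult_coset)
qed

end

section \<open>The subalgebra and its opposite as complex algebras\<close>

lemma (in unital_subalgebra) B_closed: "b \<in> B \<Longrightarrow> b \<in> carrier D"
  using subringE(1)[OF subring] by blast

lemma (in unital_subalgebra) sub_algebra_complex_algebra: "complex_algebra (sub_algebra D B)"
  unfolding complex_algebra_def
proof (intro conjI)
  show "module complex_ring (sub_algebra D B)"
    using submodule.submodule_is_module[OF submodule module_axioms] .
  show "ring (sub_algebra D B)"
    using subring_is_ring[OF subring] .
  show "complex_algebra_axioms (sub_algebra D B)"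
    by (rule complex_algebra_axioms.intro) (simp_all add: B_closed smult_mult_left smult_mult_right)
qed

lemma op_algebra_simps:
  "carrier (op_algebra A) = carrier A" "\<one>\<^bsub>op_algebra A\<^esub> = \<one>\<^bsub>A\<^esub>"
  "\<zero>\<^bsub>op_algebra A\<^esub> = \<zero>\<^bsub>A\<^esub>" "x \<oplus>\<^bsub>op_algebra A\<^esub> y = x \<oplus>\<^bsub>A\<^esub> y"
  "x \<otimes>\<^bsub>op_algebra A\<^esub> y = y \<otimes>\<^bsub>A\<^esub> x" "c \<odot>\<^bsub>op_algebra A\<^esub> x = c \<odot>\<^bsub>A\<^esub> x"
  by (simp_all add: op_algebra_def)

text \<open>Only the multiplication changes: left and right distributivity trade places, as do the
  two compatibilities with scalars.\<close>

lemma op_algebra_complex_algebra: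
  assumes "complex_algebra A"
  shows "complex_algebra (op_algebra A)"
proof -
  interpret complex_algebra A by fact
  have grp: "abelian_group (op_algebra A)"
    by (rule abelian_groupI) (auto simp: op_algebra_simps a_ac intro: l_neg)
  have "ring (op_algebra A)"
    by (rule ringI[OF grp monoidI]) (simp_all add: op_algebra_simps m_assoc l_distr r_distr)
  moreover have "module complex_ring (op_algebra A)"
    by (rule moduleI[OF R.is_cring grp])
      (simp_all add: op_algebra_simps smult_l_distr smult_r_distr smult_assoc1)
  ultimately show ?thesis
    by (auto simp: complex_algebra_def complex_algebra_axioms_def op_algebra_simps
        smult_mult_left smult_mult_right)
qed

section \<open>The quotient module\<close>

context ncps_pair_expectations
begin

abbreviation L :: "'d \<Rightarrow> 'a" where "L \<equiv> left_elt D B \<epsilon>"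
abbreviation R' :: "'d \<Rightarrow> 'a" where "R' \<equiv> right_elt D B \<epsilon>"

lemma op_sub_algebra: "complex_algebra (op_algebra (sub_algebra D B))"
  by (rule op_algebra_complex_algebra) (rule sub_algebra_complex_algebra)

text \<open>The tensor rules for \<open>B\<close> and its opposite, with the opposite operations
  unfolded so that second tensor factors multiply in reversed order.\<close>

lemmas pure_B_Bop_simps =
  pure_tensor_closed[OF sub_algebra_complex_algebra op_sub_algebra,
    folded tensor_B_Bop_def pure_B_Bop_def, simplified op_algebra_simps, simplified]
  pure_tensor_mult[OF sub_algebra_complex_algebra op_sub_algebra,
    folded tensor_B_Bop_def pure_B_Bop_def, simplified op_algebra_simps, simplified]
  pure_tensor_one[OF sub_algebra_complex_algebra op_sub_algebra,
    folded tensor_B_Bop_def pure_B_Bop_def, simplified op_algebra_simps, simplified]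
  pure_tensor_add_left[OF sub_algebra_complex_algebra op_sub_algebra,
    folded tensor_B_Bop_def pure_B_Bop_def, simplified op_algebra_simps, simplified]
  pure_tensor_add_right[OF sub_algebra_complex_algebra op_sub_algebra,
    folded tensor_B_Bop_def pure_B_Bop_def, simplified op_algebra_simps, simplified]
  pure_tensor_smult_left[OF sub_algebra_complex_algebra op_sub_algebra,
    folded tensor_B_Bop_def pure_B_Bop_def, simplified op_algebra_simps, simplified]
  pure_tensor_smult_right[OF sub_algebra_complex_algebra op_sub_algebra,
    folded tensor_B_Bop_def pure_B_Bop_def, simplified op_algebra_simps, simplified]

section \<open>Calculus of \<open>L\<close>, \<open>R'\<close> and the two expectations\<close>

lemma eps_simps:
  "U \<in> carrier (tensor_B_Bop D B) \<Longrightarrow> \<epsilon> U \<in> carrier A"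
  "\<lbrakk>U \<in> carrier (tensor_B_Bop D B); V \<in> carrier (tensor_B_Bop D B)\<rbrakk> \<Longrightarrow>
    \<epsilon> (U \<otimes>\<^bsub>tensor_B_Bop D B\<^esub> V) = \<epsilon> U \<otimes>\<^bsub>A\<^esub> \<epsilon> V"
  "\<lbrakk>U \<in> carrier (tensor_B_Bop D B); V \<in> carrier (tensor_B_Bop D B)\<rbrakk> \<Longrightarrow>
    \<epsilon> (U \<oplus>\<^bsub>tensor_B_Bop D B\<^esub> V) = \<epsilon> U \<oplus>\<^bsub>A\<^esub> \<epsilon> V"
  "\<epsilon> \<one>\<^bsub>tensor_B_Bop D B\<^esub> = \<one>\<^bsub>A\<^esub>"
  "U \<in> carrier (tensor_B_Bop D B) \<Longrightarrow>
    \<epsilon> (c \<odot>\<^bsub>tensor_B_Bop D B\<^esub> U) = c \<odot>\<^bsub>A\<^esub> \<epsilon> U"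
  using eps_hom unfolding algebra_hom_def
  by (auto simp: ring_hom_closed ring_hom_mult ring_hom_add ring_hom_one linear_mapsD)

lemma B_one [simp]: "\<one>\<^bsub>D\<^esub> \<in> B"
  using subringE(3)[OF subring] .

lemma B_mult [simp]: "\<lbrakk>a \<in> B; b \<in> B\<rbrakk> \<Longrightarrow> a \<otimes>\<^bsub>D\<^esub> b \<in> B"
  using subringE(6)[OF subring] .

lemma B_add [simp]: "\<lbrakk>a \<in> B; b \<in> B\<rbrakk> \<Longrightarrow> a \<oplus>\<^bsub>D\<^esub> b \<in> B"
  using subringE(7)[OF subring] .

lemma B_smult [simp]: "b \<in> B \<Longrightarrow> c \<odot>\<^bsub>D\<^esub> b \<in> B"
  using submoduleE(4)[OF submodule] by simp

lemma L_closed [simp]: "b \<in> B \<Longrightarrow> L b \<in> carrier A"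
  by (simp add: left_elt_def eps_simps pure_B_Bop_simps)

lemma R_closed [simp]: "b \<in> B \<Longrightarrow> R' b \<in> carrier A"
  by (simp add: right_elt_def eps_simps pure_B_Bop_simps)

lemma L_one [simp]: "L \<one>\<^bsub>D\<^esub> = \<one>\<^bsub>A\<^esub>"
  by (simp add: left_elt_def eps_simps flip: pure_B_Bop_simps(3))

lemma R_one [simp]: "R' \<one>\<^bsub>D\<^esub> = \<one>\<^bsub>A\<^esub>"
  by (simp add: right_elt_def eps_simps flip: pure_B_Bop_simps(3))

lemma L_mult: "\<lbrakk>a \<in> B; b \<in> B\<rbrakk> \<Longrightarrow> L (a \<otimes>\<^bsub>D\<^esub> b) = L a \<otimes>\<^bsub>A\<^esub> L b"
  by (simp add: left_elt_def pure_B_Bop_simps flip: eps_simps)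

lemma R_mult: "\<lbrakk>a \<in> B; b \<in> B\<rbrakk> \<Longrightarrow> R' (a \<otimes>\<^bsub>D\<^esub> b) = R' b \<otimes>\<^bsub>A\<^esub> R' a"
  by (simp add: right_elt_def pure_B_Bop_simps flip: eps_simps)

text \<open>Both products are the image under \<open>\<epsilon>\<close> of the same pure tensor of
  \<open>a\<close> and \<open>b\<close>, since in each tensor factor one of the entries is the
  unit.\<close>

lemma L_R_commute: "\<lbrakk>a \<in> B; b \<in> B\<rbrakk> \<Longrightarrow> R' b \<otimes>\<^bsub>A\<^esub> L a = L a \<otimes>\<^bsub>A\<^esub> R' b"
  by (simp add: left_elt_def right_elt_def pure_B_Bop_simps B_closed flip: eps_simps)

lemma L_add: "\<lbrakk>a \<in> B; b \<in> B\<rbrakk> \<Longrightarrow> L (a \<oplus>\<^bsub>D\<^esub> b) = L a \<oplus>\<^bsub>A\<^esub> L b"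
  by (simp add: left_elt_def pure_B_Bop_simps eps_simps)

lemma R_add: "\<lbrakk>a \<in> B; b \<in> B\<rbrakk> \<Longrightarrow> R' (a \<oplus>\<^bsub>D\<^esub> b) = R' a \<oplus>\<^bsub>A\<^esub> R' b"
  by (simp add: right_elt_def pure_B_Bop_simps eps_simps)

lemma L_smult: "b \<in> B \<Longrightarrow> L (c \<odot>\<^bsub>D\<^esub> b) = c \<odot>\<^bsub>A\<^esub> L b"
  by (simp add: left_elt_def pure_B_Bop_simps eps_simps)

lemma R_smult: "b \<in> B \<Longrightarrow> R' (c \<odot>\<^bsub>D\<^esub> b) = c \<odot>\<^bsub>A\<^esub> R' b"
  by (simp add: right_elt_def pure_B_Bop_simps eps_simps)

lemma E_closed [simp]: "Z \<in> carrier A \<Longrightarrow> E Z \<in> B"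
  using linear_mapsD(1)[OF E_linear] by simp

lemma F_closed [simp]: "Z \<in> carrier A \<Longrightarrow> F Z \<in> carrier D"
  using linear_mapsD(1)[OF F_linear] .

lemma E_add: "\<lbrakk>Y \<in> carrier A; Z \<in> carrier A\<rbrakk> \<Longrightarrow> E (Y \<oplus>\<^bsub>A\<^esub> Z) = E Y \<oplus>\<^bsub>D\<^esub> E Z"
  using linear_mapsD(2)[OF E_linear] by simp

lemma F_add: "\<lbrakk>Y \<in> carrier A; Z \<in> carrier A\<rbrakk> \<Longrightarrow> F (Y \<oplus>\<^bsub>A\<^esub> Z) = F Y \<oplus>\<^bsub>D\<^esub> F Z"
  using linear_mapsD(2)[OF F_linear] .

lemma E_smult: "Z \<in> carrier A \<Longrightarrow> E (c \<odot>\<^bsub>A\<^esub> Z) = c \<odot>\<^bsub>D\<^esub> E Z"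
  using linear_mapsD(3)[OF E_linear] by simp

lemma F_smult: "Z \<in> carrier A \<Longrightarrow> F (c \<odot>\<^bsub>A\<^esub> Z) = c \<odot>\<^bsub>D\<^esub> F Z"
  using linear_mapsD(3)[OF F_linear] .

lemma E_zero: "E \<zero>\<^bsub>A\<^esub> = \<zero>\<^bsub>D\<^esub>"
  using E_add[of "\<zero>\<^bsub>A\<^esub>" "\<zero>\<^bsub>A\<^esub>"] B_closed[OF E_closed[of "\<zero>\<^bsub>A\<^esub>"]] by simp

lemma E_lmult: "\<lbrakk>b \<in> B; Z \<in> carrier A\<rbrakk> \<Longrightarrow> E (L b \<otimes>\<^bsub>A\<^esub> Z) = b \<otimes>\<^bsub>D\<^esub> E Z"
  using E_bimodule[of b "\<one>\<^bsub>D\<^esub>" Z] by (simp add: B_closed)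

lemma E_rmult: "\<lbrakk>b \<in> B; Z \<in> carrier A\<rbrakk> \<Longrightarrow> E (R' b \<otimes>\<^bsub>A\<^esub> Z) = E Z \<otimes>\<^bsub>D\<^esub> b"
  using E_bimodule[of "\<one>\<^bsub>D\<^esub>" b Z] by (simp add: B_closed)

lemma F_lmult: "\<lbrakk>b \<in> B; Z \<in> carrier A\<rbrakk> \<Longrightarrow> F (L b \<otimes>\<^bsub>A\<^esub> Z) = b \<otimes>\<^bsub>D\<^esub> F Z"
  using F_bimodule[of b "\<one>\<^bsub>D\<^esub>" Z] by (simp add: B_closed)

lemma F_rmult: "\<lbrakk>b \<in> B; Z \<in> carrier A\<rbrakk> \<Longrightarrow> F (R' b \<otimes>\<^bsub>A\<^esub> Z) = F Z \<otimes>\<^bsub>D\<^esub> b"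
  using F_bimodule[of "\<one>\<^bsub>D\<^esub>" b Z] by (simp add: B_closed)

text \<open>Left linearity and unitality make \<open>L\<close> a section of \<open>E\<close>; this
  provides the summand \<open>B\<close> of the quotient.\<close>

lemma E_L: "b \<in> B \<Longrightarrow> E (L b) = b"
  using E_lmult[of b "\<one>\<^bsub>A\<^esub>"] by (simp add: E_unital B_closed)

section \<open>Equivalence modulo the left ideal\<close>

text \<open>
  The largest left ideal on which both expectations vanish replaces the left ideal spanned by the
  elements \<open>Z (L b - R' b)\<close>, and no spans have to be handled.
\<close>

definition eqv :: "'a \<Rightarrow> 'a \<Rightarrow> bool" where
  "eqv Y Z \<longleftrightarrow> (\<forall>W\<in>carrier A. E (W \<otimes>\<^bsub>A\<^esub> Y) = E (W \<otimes>\<^bsub>A\<^esub> Z) \<and> F (W \<otimes>\<^bsub>A\<^esub> Y) = F (W \<otimes>\<^bsub>A\<^esub> Z))"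

definition cls :: "'a \<Rightarrow> 'a set" where
  "cls Z = {Y \<in> carrier A. eqv Y Z}"

lemma eqv_refl: "eqv Z Z"
  by (simp add: eqv_def)

lemma eqv_sym: "eqv Y Z \<Longrightarrow> eqv Z Y"
  by (simp add: eqv_def)

lemma eqv_trans: "\<lbrakk>eqv V Y; eqv Y Z\<rbrakk> \<Longrightarrow> eqv V Z"
  by (simp add: eqv_def)

lemma cls_eq_iff: "\<lbrakk>Y \<in> carrier A; Z \<in> carrier A\<rbrakk> \<Longrightarrow> cls Y = cls Z \<longleftrightarrow> eqv Y Z"
  unfolding cls_def using eqv_refl eqv_sym eqv_trans by blast

lemma eqv_E: "\<lbrakk>eqv Y Z; Y \<in> carrier A; Z \<in> carrier A\<rbrakk> \<Longrightarrow> E Y = E Z"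
  unfolding eqv_def by (metis A.l_one A.one_closed)

lemma eqv_F: "\<lbrakk>eqv Y Z; Y \<in> carrier A; Z \<in> carrier A\<rbrakk> \<Longrightarrow> F Y = F Z"
  unfolding eqv_def by (metis A.l_one A.one_closed)

lemma eqv_add:
  "\<lbrakk>eqv Y Y'; eqv Z Z'; Y \<in> carrier A; Y' \<in> carrier A; Z \<in> carrier A; Z' \<in> carrier A\<rbrakk> \<Longrightarrow>
    eqv (Y \<oplus>\<^bsub>A\<^esub> Z) (Y' \<oplus>\<^bsub>A\<^esub> Z')"
  by (simp add: eqv_def A.r_distr E_add F_add)

lemma eqv_smult:
  "\<lbrakk>eqv Y Z; Y \<in> carrier A; Z \<in> carrier A\<rbrakk> \<Longrightarrow> eqv (c \<odot>\<^bsub>A\<^esub> Y) (c \<odot>\<^bsub>A\<^esub> Z)"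
  by (simp add: eqv_def A.smult_mult_right E_smult F_smult)

text \<open>The test multipliers \<open>W\<close> range over all of \<open>A\<close>, so
  \<open>W V\<close> is again one of them. This makes the quotient a left module over
  \<open>A\<close>.\<close>

lemma eqv_lmult:
  "\<lbrakk>eqv Y Z; V \<in> carrier A; Y \<in> carrier A; Z \<in> carrier A\<rbrakk> \<Longrightarrow> eqv (V \<otimes>\<^bsub>A\<^esub> Y) (V \<otimes>\<^bsub>A\<^esub> Z)"
  by (simp add: eqv_def flip: A.m_assoc)

text \<open>Negation is left multiplication by the negative of the unit.\<close>

lemma eqv_minus:
  assumes "eqv Y Z" "Y \<in> carrier A" "Z \<in> carrier A"
  shows "eqv (\<ominus>\<^bsub>A\<^esub> Y) (\<ominus>\<^bsub>A\<^esub> Z)"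
  using eqv_lmult[OF assms(1), of "\<ominus>\<^bsub>A\<^esub> \<one>\<^bsub>A\<^esub>"] assms by (simp add: A.l_minus)

text \<open>After reassociating, \<open>W Z\<close> stands to the left of \<open>L b\<close> or
  \<open>R' b\<close>, and the hypotheses \<open>E_left_right\<close> and
  \<open>F_left_right\<close> apply.\<close>

lemma eqv_L_R: "\<lbrakk>b \<in> B; Z \<in> carrier A\<rbrakk> \<Longrightarrow> eqv (Z \<otimes>\<^bsub>A\<^esub> L b) (Z \<otimes>\<^bsub>A\<^esub> R' b)"
  by (simp add: eqv_def E_left_right F_left_right flip: A.m_assoc)

section \<open>The kernel of \<open>E\<close> modulo the equivalence, as a bimodule\<close>

abbreviation rep :: "'a set \<Rightarrow> 'a" where
  "rep \<equiv> inv_into (carrier A) cls"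

lemma rep_cls:
  assumes "Z \<in> carrier A"
  shows "rep (cls Z) \<in> carrier A" "eqv (rep (cls Z)) Z"
proof -
  show "rep (cls Z) \<in> carrier A"
    using assms by (simp add: inv_into_into)
  then show "eqv (rep (cls Z)) Z"
    using assms f_inv_into_f[of "cls Z" cls "carrier A"] by (simp add: cls_eq_iff[symmetric])
qed

text \<open>Operations on classes go through chosen representatives. Both actions, the right one
  included, multiply on the left in \<open>A\<close>, since the equivalence is a congruence for left
  multiplication.\<close>

definition \<XX>\<^sub>0 :: "('d, 'a set) bimodule" where
  "\<XX>\<^sub>0 = \<lparr>carrier = cls ` {Z \<in> carrier A. E Z = \<zero>\<^bsub>D\<^esub>},
     monoid.mult = undefined, one = undefined,
     ring.zero = cls \<zero>\<^bsub>A\<^esub>,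
     ring.add = \<lambda>U V. cls (rep U \<oplus>\<^bsub>A\<^esub> rep V),
     module.smult = \<lambda>c U. cls (c \<odot>\<^bsub>A\<^esub> rep U),
     lact = \<lambda>b U. cls (L b \<otimes>\<^bsub>A\<^esub> rep U),
     ract = \<lambda>U b. cls (R' b \<otimes>\<^bsub>A\<^esub> rep U)\<rparr>"

lemma cls_in_X0: "\<lbrakk>Z \<in> carrier A; E Z = \<zero>\<^bsub>D\<^esub>\<rbrakk> \<Longrightarrow> cls Z \<in> carrier \<XX>\<^sub>0"
  by (simp add: \<XX>\<^sub>0_def)

lemma X0_cases:
  assumes "U \<in> carrier \<XX>\<^sub>0"
  obtains Z where "Z \<in> carrier A" "E Z = \<zero>\<^bsub>D\<^esub>" "U = cls Z"
  using assms by (auto simp: \<XX>\<^sub>0_def)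

text \<open>A chosen representative is merely equivalent to the given element; the congruence
  properties of \<open>eqv\<close> make the operations independent of the choice.\<close>

lemma X0_simps:
  "\<zero>\<^bsub>\<XX>\<^sub>0\<^esub> = cls \<zero>\<^bsub>A\<^esub>"
  "\<lbrakk>Y \<in> carrier A; Z \<in> carrier A\<rbrakk> \<Longrightarrow> cls Y \<oplus>\<^bsub>\<XX>\<^sub>0\<^esub> cls Z = cls (Y \<oplus>\<^bsub>A\<^esub> Z)"
  "Z \<in> carrier A \<Longrightarrow> c \<odot>\<^bsub>\<XX>\<^sub>0\<^esub> cls Z = cls (c \<odot>\<^bsub>A\<^esub> Z)"
  "\<lbrakk>b \<in> B; Z \<in> carrier A\<rbrakk> \<Longrightarrow> lact \<XX>\<^sub>0 b (cls Z) = cls (L b \<otimes>\<^bsub>A\<^esub> Z)"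
  "\<lbrakk>b \<in> B; Z \<in> carrier A\<rbrakk> \<Longrightarrow> ract \<XX>\<^sub>0 (cls Z) b = cls (R' b \<otimes>\<^bsub>A\<^esub> Z)"
  using rep_cls
  by (simp_all add: \<XX>\<^sub>0_def cls_eq_iff eqv_add eqv_smult eqv_lmult)

lemma X0_closed:
  "\<zero>\<^bsub>\<XX>\<^sub>0\<^esub> \<in> carrier \<XX>\<^sub>0"
  "\<lbrakk>U \<in> carrier \<XX>\<^sub>0; V \<in> carrier \<XX>\<^sub>0\<rbrakk> \<Longrightarrow> U \<oplus>\<^bsub>\<XX>\<^sub>0\<^esub> V \<in> carrier \<XX>\<^sub>0"
  "U \<in> carrier \<XX>\<^sub>0 \<Longrightarrow> c \<odot>\<^bsub>\<XX>\<^sub>0\<^esub> U \<in> carrier \<XX>\<^sub>0"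
  "\<lbrakk>b \<in> B; U \<in> carrier \<XX>\<^sub>0\<rbrakk> \<Longrightarrow> lact \<XX>\<^sub>0 b U \<in> carrier \<XX>\<^sub>0"
  "\<lbrakk>b \<in> B; U \<in> carrier \<XX>\<^sub>0\<rbrakk> \<Longrightarrow> ract \<XX>\<^sub>0 U b \<in> carrier \<XX>\<^sub>0"
proof -
  show "\<zero>\<^bsub>\<XX>\<^sub>0\<^esub> \<in> carrier \<XX>\<^sub>0"
    by (simp add: X0_simps cls_in_X0 E_zero)
  show "U \<oplus>\<^bsub>\<XX>\<^sub>0\<^esub> V \<in> carrier \<XX>\<^sub>0" if "U \<in> carrier \<XX>\<^sub>0" "V \<in> carrier \<XX>\<^sub>0"
    using that by (elim X0_cases) (simp add: X0_simps cls_in_X0 E_add)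
  show "c \<odot>\<^bsub>\<XX>\<^sub>0\<^esub> U \<in> carrier \<XX>\<^sub>0" if "U \<in> carrier \<XX>\<^sub>0"
    using that by (elim X0_cases) (simp add: X0_simps cls_in_X0 E_smult)
  show "lact \<XX>\<^sub>0 b U \<in> carrier \<XX>\<^sub>0" if "b \<in> B" "U \<in> carrier \<XX>\<^sub>0"
    using that(2,1) by (elim X0_cases) (simp add: X0_simps cls_in_X0 E_lmult B_closed)
  show "ract \<XX>\<^sub>0 U b \<in> carrier \<XX>\<^sub>0" if "b \<in> B" "U \<in> carrier \<XX>\<^sub>0"
    using that(2,1) by (elim X0_cases) (simp add: X0_simps cls_in_X0 E_rmult B_closed)
qed

text \<open>On classes each axiom is an identity in \<open>A\<close>. The reversed order in
  \<open>R_mult\<close> yields a right action, and \<open>L_R_commute\<close> makes the two actions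
  commute.\<close>

lemma X0_bimodule: "bimodule (sub_algebra D B) \<XX>\<^sub>0"
proof -
  have abelian: "abelian_group \<XX>\<^sub>0"
  proof (rule abelian_groupI)
    fix U assume "U \<in> carrier \<XX>\<^sub>0"
    then obtain Z where Z: "Z \<in> carrier A" "E Z = \<zero>\<^bsub>D\<^esub>" "U = cls Z"
      by (rule X0_cases)
    then have "E (\<ominus>\<^bsub>A\<^esub> Z) = \<zero>\<^bsub>D\<^esub>"
      using E_add[of "\<ominus>\<^bsub>A\<^esub> Z" Z] by (simp add: A.l_neg E_zero B_closed)
    with Z show "\<exists>V\<in>carrier \<XX>\<^sub>0. V \<oplus>\<^bsub>\<XX>\<^sub>0\<^esub> U = \<zero>\<^bsub>\<XX>\<^sub>0\<^esub>"
      by (intro bexI[of _ "cls (\<ominus>\<^bsub>A\<^esub> Z)"]) (auto simp: X0_simps cls_in_X0 A.l_neg)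
  qed (auto simp: X0_closed X0_simps cls_in_X0 E_zero A.a_ac elim!: X0_cases)
  have "module complex_ring \<XX>\<^sub>0"
    by (rule moduleI[OF R.is_cring abelian])
      (auto simp: X0_closed X0_simps A.smult_l_distr A.smult_r_distr A.smult_assoc1
        elim!: X0_cases)
  moreover have "bimodule_axioms (sub_algebra D B) \<XX>\<^sub>0"
    by (rule bimodule_axioms.intro; (intro linear_mapsI)?)
      (auto simp: X0_closed X0_simps A.l_distr A.r_distr A.smult_mult_left
        A.smult_mult_right L_mult R_mult L_add R_add L_smult R_smult L_R_commute
        simp flip: A.m_assoc elim!: X0_cases)
  ultimately show ?thesis
    by (simp add: bimodule_def sub_algebra_complex_algebra)
qed

section \<open>The direct sum and its identification with the quotient\<close>

definition \<XX> :: "('d, 'd \<times> 'a set) bimodule" where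
  "\<XX> = bimodule_sum (regular_bimodule (sub_algebra D B)) \<XX>\<^sub>0"

lemma X_simps:
  "carrier \<XX> = B \<times> carrier \<XX>\<^sub>0"
  "(b, U) \<oplus>\<^bsub>\<XX>\<^esub> (b', U') = (b \<oplus>\<^bsub>D\<^esub> b', U \<oplus>\<^bsub>\<XX>\<^sub>0\<^esub> U')"
  "\<zero>\<^bsub>\<XX>\<^esub> = (\<zero>\<^bsub>D\<^esub>, \<zero>\<^bsub>\<XX>\<^sub>0\<^esub>)"
  "c \<odot>\<^bsub>\<XX>\<^esub> (b, U) = (c \<odot>\<^bsub>D\<^esub> b, c \<odot>\<^bsub>\<XX>\<^sub>0\<^esub> U)"
  "lact \<XX> a (b, U) = (a \<otimes>\<^bsub>D\<^esub> b, lact \<XX>\<^sub>0 a U)"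
  "ract \<XX> (b, U) a = (b \<otimes>\<^bsub>D\<^esub> a, ract \<XX>\<^sub>0 U a)"
  by (simp_all add: \<XX>_def bimodule_sum_def regular_bimodule_def module.defs bimodule.defs)

text \<open>
  The quotient of \<open>A\<close> by \<open>eqv\<close>, identified with \<open>B \<oplus> \<XX>\<^sub>0\<close>: the class of \<open>L b \<oplus> W\<close> with
  \<open>E W = 0\<close> corresponds to \<open>(b, cls W)\<close>.
\<close>

definition \<kappa> :: "'a \<Rightarrow> 'd \<times> 'a set" where
  "\<kappa> V = (E V, cls (V \<oplus>\<^bsub>A\<^esub> (\<ominus>\<^bsub>A\<^esub> L (E V))))"

lemma \<kappa>_one: "\<kappa> \<one>\<^bsub>A\<^esub> = (\<one>\<^bsub>D\<^esub>, \<zero>\<^bsub>\<XX>\<^sub>0\<^esub>)"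
  by (simp add: \<kappa>_def E_unital X0_simps A.r_neg)

lemma \<kappa>_add:
  assumes "V \<in> carrier A" "W \<in> carrier A"
  shows "\<kappa> (V \<oplus>\<^bsub>A\<^esub> W) = \<kappa> V \<oplus>\<^bsub>\<XX>\<^esub> \<kappa> W"
  using assms by (simp add: \<kappa>_def X_simps X0_simps E_add L_add A.minus_add A.a_ac)

lemma \<kappa>_smult: "V \<in> carrier A \<Longrightarrow> \<kappa> (c \<odot>\<^bsub>A\<^esub> V) = c \<odot>\<^bsub>\<XX>\<^esub> \<kappa> V"
  by (simp add: \<kappa>_def X_simps X0_simps E_smult L_smult A.smult_r_distr A.smult_r_minus)

lemma \<kappa>_lact: "\<lbrakk>b \<in> B; V \<in> carrier A\<rbrakk> \<Longrightarrow> \<kappa> (L b \<otimes>\<^bsub>A\<^esub> V) = lact \<XX> b (\<kappa> V)"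
  by (simp add: \<kappa>_def X_simps X0_simps E_lmult L_mult A.r_distr A.r_minus)

text \<open>With \<open>c = E V\<close>, the left side subtracts \<open>L c L b\<close>, whereas the
  right action subtracts \<open>R' b L c = L c R' b\<close>. These differ in \<open>A\<close> but
  are equivalent by \<open>eqv_L_R\<close>, so the splitting respects the right action.\<close>

lemma \<kappa>_ract:
  assumes "b \<in> B" "V \<in> carrier A"
  shows "\<kappa> (R' b \<otimes>\<^bsub>A\<^esub> V) = ract \<XX> (\<kappa> V) b"
proof -
  have "eqv (\<ominus>\<^bsub>A\<^esub> (L (E V) \<otimes>\<^bsub>A\<^esub> L b)) (\<ominus>\<^bsub>A\<^esub> (L (E V) \<otimes>\<^bsub>A\<^esub> R' b))"
    using assms by (intro eqv_minus eqv_L_R) auto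
  then show ?thesis
    using assms by (simp add: \<kappa>_def X_simps X0_simps E_rmult L_mult A.r_distr A.r_minus
        L_R_commute cls_eq_iff eqv_add eqv_refl)
qed

text \<open>Equal first components mean that the same element \<open>L (E W)\<close> was subtracted
  on both sides, so it can be added back.\<close>

lemma \<kappa>_eq_iff:
  assumes "V \<in> carrier A" "W \<in> carrier A"
  shows "\<kappa> V = \<kappa> W \<longleftrightarrow> eqv V W"
proof
  assume "eqv V W"
  then show "\<kappa> V = \<kappa> W"
    using assms eqv_E[of V W] by (simp add: \<kappa>_def cls_eq_iff eqv_add eqv_refl)
next
  assume "\<kappa> V = \<kappa> W"
  then have E: "E V = E W"
    and "eqv (V \<oplus>\<^bsub>A\<^esub> (\<ominus>\<^bsub>A\<^esub> L (E W))) (W \<oplus>\<^bsub>A\<^esub> (\<ominus>\<^bsub>A\<^esub> L (E W)))"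
    using assms by (auto simp: \<kappa>_def cls_eq_iff)
  then have "eqv (V \<oplus>\<^bsub>A\<^esub> (\<ominus>\<^bsub>A\<^esub> L (E W)) \<oplus>\<^bsub>A\<^esub> L (E W)) (W \<oplus>\<^bsub>A\<^esub> (\<ominus>\<^bsub>A\<^esub> L (E W)) \<oplus>\<^bsub>A\<^esub> L (E W))"
    using assms by (simp only: eqv_add[OF _ eqv_refl] L_closed E_closed A.add.m_closed A.a_inv_closed)
  then show "eqv V W"
    using assms by (simp add: A.a_assoc A.l_neg)
qed

text \<open>Together with \<open>\<kappa>_eq_iff\<close> this identifies \<open>\<XX>\<close> with
  \<open>A\<close> modulo \<open>eqv\<close>. Every vector then has the form
  \<open>\<kappa> V\<close>, and claims about \<open>\<XX>\<close> become claims about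
  \<open>A\<close>.\<close>

lemma X_carrier: "carrier \<XX> = \<kappa> ` carrier A"
proof
  show "\<kappa> ` carrier A \<subseteq> carrier \<XX>"
  proof
    fix x assume "x \<in> \<kappa> ` carrier A"
    then obtain V where V: "V \<in> carrier A" "x = \<kappa> V" by blast
    \<comment> \<open>By \<open>E_L\<close> the second summand is \<open>E V\<close> itself, so
      cancellation puts \<open>V - L (E V)\<close> in the kernel of \<open>E\<close>.\<close>
    have "E (V \<oplus>\<^bsub>A\<^esub> (\<ominus>\<^bsub>A\<^esub> L (E V))) \<oplus>\<^bsub>D\<^esub> E (L (E V)) = E V"
      using V by (simp add: A.a_assoc A.l_neg flip: E_add)
    then have "E (V \<oplus>\<^bsub>A\<^esub> (\<ominus>\<^bsub>A\<^esub> L (E V))) = \<zero>\<^bsub>D\<^esub>"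
      using V by (simp add: E_L B_closed)
    then show "x \<in> carrier \<XX>"
      using V by (simp add: X_simps cls_in_X0 \<kappa>_def)
  qed
  show "carrier \<XX> \<subseteq> \<kappa> ` carrier A"
  proof
    fix x assume "x \<in> carrier \<XX>"
    then obtain b W where bW: "b \<in> B" "W \<in> carrier A" "E W = \<zero>\<^bsub>D\<^esub>" "x = (b, cls W)"
      by (auto simp: X_simps elim!: X0_cases)
    \<comment> \<open>The preimage is \<open>W + L b\<close>: its expectation is \<open>b\<close>,
      and subtracting \<open>L b\<close> leaves \<open>W\<close>.\<close>
    then have E: "E (W \<oplus>\<^bsub>A\<^esub> L b) = b"
      by (simp add: E_add E_L B_closed)
    have "\<kappa> (W \<oplus>\<^bsub>A\<^esub> L b) = x"
      using bW by (simp add: \<kappa>_def E A.a_assoc A.r_neg)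
    then show "x \<in> \<kappa> ` carrier A"
      using bW by (intro image_eqI[of _ \<kappa> "W \<oplus>\<^bsub>A\<^esub> L b"]) auto
  qed
qed

section \<open>The second state and the representation\<close>

abbreviation rep\<kappa> :: "'d \<times> 'a set \<Rightarrow> 'a" where
  "rep\<kappa> \<equiv> inv_into (carrier A) \<kappa>"

lemma rep\<kappa>:
  assumes "V \<in> carrier A"
  shows "rep\<kappa> (\<kappa> V) \<in> carrier A" "eqv (rep\<kappa> (\<kappa> V)) V"
proof -
  show "rep\<kappa> (\<kappa> V) \<in> carrier A"
    using assms by (simp add: inv_into_into)
  then show "eqv (rep\<kappa> (\<kappa> V)) V"
    using assms f_inv_into_f[of "\<kappa> V" \<kappa> "carrier A"] by (simp add: \<kappa>_eq_iff[symmetric])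
qed

definition q :: "'d \<times> 'a set \<Rightarrow> 'd" where
  "q x = F (rep\<kappa> x)"

lemma q_\<kappa>: "V \<in> carrier A \<Longrightarrow> q (\<kappa> V) = F V"
  using rep\<kappa>[of V] eqv_F by (simp add: q_def)

definition \<theta> :: "'a \<Rightarrow> 'd \<times> 'a set \<Rightarrow> 'd \<times> 'a set" where
  "\<theta> Z = (\<lambda>x\<in>carrier \<XX>. \<kappa> (Z \<otimes>\<^bsub>A\<^esub> rep\<kappa> x))"

text \<open>Left multiplication preserves \<open>eqv\<close>, so the representative chosen in
  \<open>\<theta>\<close> does not matter.\<close>

lemma \<theta>_\<kappa>: "\<lbrakk>Z \<in> carrier A; V \<in> carrier A\<rbrakk> \<Longrightarrow> \<theta> Z (\<kappa> V) = \<kappa> (Z \<otimes>\<^bsub>A\<^esub> V)"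
  using rep\<kappa>[of V] by (simp add: \<theta>_def X_carrier \<kappa>_eq_iff eqv_lmult)

text \<open>Along \<open>\<kappa>\<close> the map \<open>q\<close> becomes \<open>F\<close>, so its
  axioms are those of \<open>F\<close>; the vector on which it must equal 1 is
  \<open>\<kappa>\<close> of the unit of \<open>A\<close>.\<close>

lemma X_specified_states: "bimodule_specified_states D B \<XX> \<XX>\<^sub>0 fst q"
proof -
  have "bimodule_specified_states_axioms D B \<XX> \<XX>\<^sub>0 fst q"
    by (rule bimodule_specified_states_axioms.intro; (intro linear_mapsI)?)
      (auto simp: \<XX>_def[symmetric] X_carrier q_\<kappa> F_add F_smult F_lmult F_rmult
        simp flip: \<kappa>_add \<kappa>_smult \<kappa>_lact \<kappa>_ract \<kappa>_one intro: F_unital)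
  then show ?thesis
    by (simp add: bimodule_specified_states_def X0_bimodule unital_subalgebra_axioms)
qed

lemma \<theta>_extensional: "\<theta> Z \<in> extensional (carrier \<XX>)"
  by (simp add: \<theta>_def)

text \<open>Reduces equations between operators to equations in \<open>A\<close>, since the vectors
  \<open>\<kappa> V\<close> exhaust the carrier.\<close>

lemma X_operator_eqI:
  assumes "S \<in> extensional (carrier \<XX>)" "T \<in> extensional (carrier \<XX>)"
    and "\<And>V. V \<in> carrier A \<Longrightarrow> S (\<kappa> V) = T (\<kappa> V)"
  shows "S = T"
  using assms by (intro extensionalityI[of S "carrier \<XX>" T]) (auto simp: X_carrier)

lemma \<theta>_closed: "Z \<in> carrier A \<Longrightarrow> \<theta> Z \<in> carrier (linear_operators \<XX>)"
  unfolding linear_operators_simps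
  by (intro IntI linear_mapsI \<theta>_extensional)
    (auto simp: X_carrier \<theta>_\<kappa> A.r_distr A.smult_mult_right simp flip: \<kappa>_add \<kappa>_smult)

lemma \<theta>_add:
  "\<lbrakk>Y \<in> carrier A; Z \<in> carrier A\<rbrakk> \<Longrightarrow> \<theta> (Y \<oplus>\<^bsub>A\<^esub> Z) = \<theta> Y \<oplus>\<^bsub>linear_operators \<XX>\<^esub> \<theta> Z"
  unfolding linear_operators_simps
  by (intro X_operator_eqI \<theta>_extensional)
    (auto simp: \<theta>_\<kappa> X_carrier A.l_distr simp flip: \<kappa>_add)

lemma \<theta>_algebra_hom: "\<theta> \<in> algebra_hom A (linear_operators \<XX>)"
  unfolding algebra_hom_def
proof (intro IntI ring_hom_memI linear_mapsI)
  fix Y Z assume "Y \<in> carrier A" "Z \<in> carrier A"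
  then show "\<theta> (Y \<otimes>\<^bsub>A\<^esub> Z) = \<theta> Y \<otimes>\<^bsub>linear_operators \<XX>\<^esub> \<theta> Z"
    unfolding linear_operators_simps
    by (intro X_operator_eqI \<theta>_extensional)
      (auto simp: \<theta>_\<kappa> compose_def X_carrier A.m_assoc)
next
  show "\<theta> \<one>\<^bsub>A\<^esub> = \<one>\<^bsub>linear_operators \<XX>\<^esub>"
    unfolding linear_operators_simps
    by (intro X_operator_eqI \<theta>_extensional) (auto simp: \<theta>_\<kappa> X_carrier)
next
  fix c Z assume "Z \<in> carrier A"
  then show "\<theta> (c \<odot>\<^bsub>A\<^esub> Z) = c \<odot>\<^bsub>linear_operators \<XX>\<^esub> \<theta> Z"
    unfolding linear_operators_simps
    by (intro X_operator_eqI \<theta>_extensional)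
      (auto simp: \<theta>_\<kappa> X_carrier A.smult_mult_left simp flip: \<kappa>_smult)
qed (auto simp: \<theta>_closed \<theta>_add)

lemma \<theta>_L: "b \<in> B \<Longrightarrow> \<theta> (L b) = left_op \<XX> b"
  unfolding left_op_def
  by (intro X_operator_eqI \<theta>_extensional) (auto simp: \<theta>_\<kappa> X_carrier \<kappa>_lact)

lemma \<theta>_R: "b \<in> B \<Longrightarrow> \<theta> (R' b) = right_op \<XX> b"
  unfolding right_op_def
  by (intro X_operator_eqI \<theta>_extensional) (auto simp: \<theta>_\<kappa> X_carrier \<kappa>_ract)

lemma \<theta>_mult:
  "\<lbrakk>Y \<in> carrier A; Z \<in> carrier A\<rbrakk> \<Longrightarrow> \<theta> (Y \<otimes>\<^bsub>A\<^esub> Z) = \<theta> Y \<otimes>\<^bsub>linear_operators \<XX>\<^esub> \<theta> Z"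
  using \<theta>_algebra_hom by (simp add: algebra_hom_def ring_hom_mult)

text \<open>The right operators on \<open>\<XX>\<close> are the images
  \<open>\<theta> (R' b)\<close>, so the multiplicative map \<open>\<theta>\<close> carries
  commutation in \<open>A\<close> over to operators.\<close>

lemma \<theta>_left_algebra: "\<theta> ` left_algebra D B A \<epsilon> \<subseteq> left_operators B \<XX>"
  by (auto simp: left_algebra_def left_operators_def commutant_def \<theta>_closed
      simp flip: \<theta>_R \<theta>_mult)

lemma \<theta>_right_algebra: "\<theta> ` right_algebra D B A \<epsilon> \<subseteq> right_operators B \<XX>"
  by (auto simp: right_algebra_def right_operators_def commutant_def \<theta>_closed
      simp flip: \<theta>_L \<theta>_mult)

end

theorem theorem3p5:
  fixes D :: "(complex, 'd) module" and B :: "'d set" and A :: "(complex, 'a) module"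
    and E F :: "'a \<Rightarrow> 'd" and \<epsilon> :: "('d \<times> 'd \<Rightarrow>\<^sub>0 complex) set \<Rightarrow> 'a"
  assumes "ncps_pair_expectations D B A E F \<epsilon>"
  shows "\<exists>(\<XX> :: ('d, 'd \<times> 'a set) bimodule) (\<XX>\<^sub>0 :: ('d, 'a set) bimodule) p q \<theta>.
    bimodule_specified_states D B \<XX> \<XX>\<^sub>0 p q \<and>
    \<theta> \<in> algebra_hom A (linear_operators \<XX>) \<and>
    (\<forall>b1\<in>B. \<forall>b2\<in>B.
      \<theta> (left_elt D B \<epsilon> b1 \<otimes>\<^bsub>A\<^esub> right_elt D B \<epsilon> b2)
        = left_op \<XX> b1 \<otimes>\<^bsub>linear_operators \<XX>\<^esub> right_op \<XX> b2) \<and>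
    \<theta> ` left_algebra D B A \<epsilon> \<subseteq> left_operators B \<XX> \<and>
    \<theta> ` right_algebra D B A \<epsilon> \<subseteq> right_operators B \<XX> \<and>
    (\<forall>Z\<in>carrier A. operator_expectation D \<XX>\<^sub>0 p (\<theta> Z) = E Z) \<and>
    (\<forall>Z\<in>carrier A. operator_expectation D \<XX>\<^sub>0 q (\<theta> Z) = F Z)"
proof -
  interpret ncps_pair_expectations D B A E F \<epsilon> by fact
  \<comment> \<open>The distinguished vector is \<open>\<kappa>\<close> of the unit, so
    \<open>\<theta> Z\<close> sends it to \<open>\<kappa> Z\<close>, whose first component is
    \<open>E Z\<close> and whose value under \<open>q\<close> is \<open>F Z\<close>.\<close>
  have "\<theta> Z (\<one>\<^bsub>D\<^esub>, \<zero>\<^bsub>\<XX>\<^sub>0\<^esub>) = \<kappa> Z" if "Z \<in> carrier A" for Z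
    using that by (simp add: \<theta>_\<kappa> flip: \<kappa>_one)
  then show ?thesis
    using X_specified_states \<theta>_algebra_hom \<theta>_left_algebra \<theta>_right_algebra
    by (intro exI[of _ \<XX>] exI[of _ \<XX>\<^sub>0] exI[of _ fst] exI[of _ q] exI[of _ \<theta>])
      (simp add: operator_expectation_def \<theta>_mult \<theta>_L \<theta>_R q_\<kappa>, simp add: \<kappa>_def)
qed

end
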